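(* Let $n\ge 1$ and let $A,B\in M_n(\mathbb{C})$ satisfy $\|A\|=1=\|B\|$. If $A\perp_P B$, then for every $\lambda\in\mathbb{C}$ the matrix $A+\lambda B$ is not invertible.
   Context: $M_n(\mathbb{C})$ carries the operator norm (as operators on the Hilbert space $\mathbb{C}^n$). For vectors $x,y$ in a complex normed space, $x\perp_P y$ (Pythagoras orthogonality) means that there exists a linear isometry $f$ from the linear span of $\{x,y\}$ into a Hilbert space such that $f(x)$ and $f(y)$ are orthogonal. Equivalently, $\|\alpha x+\beta y\|^2=|\alpha|^2\|x\|^2+|\beta|^2\|y\|^2$ for all $\alpha,\beta\in\mathbb{C}$; when $\|x\|=1=\|y\|$ this says $\|x+\lambda y\|^2=1+|\lambda|^2$ for all $\lambda\in\mathbb{C}$. *)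

theory Defs
  imports "HOL-Analysis.Analysis"
begin

locale complex_normed_space = vector_space scl
  for scl :: "complex \<Rightarrow> 'a::ab_group_add \<Rightarrow> 'a" +
  fixes nrm :: "'a \<Rightarrow> real"
  assumes nrm_eq_0_iff: "nrm x = 0 \<longleftrightarrow> x = 0"
    and nrm_triangle: "nrm (x + y) \<le> nrm x + nrm y"
    and nrm_scale: "nrm (scl c x) = cmod c * nrm x"

definition ip_norm :: "('h \<Rightarrow> 'h \<Rightarrow> complex) \<Rightarrow> 'h \<Rightarrow> real" where
  "ip_norm ip x = sqrt (Re (ip x x))"

text \<open>The inner product is linear in its first argument.\<close>

locale complex_hilbert_space = vector_space scl
  for scl :: "complex \<Rightarrow> 'h::ab_group_add \<Rightarrow> 'h" +
  fixes ip :: "'h \<Rightarrow> 'h \<Rightarrow> complex"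
  assumes ip_cnj: "ip x y = cnj (ip y x)"
    and ip_add: "ip (x + y) z = ip x z + ip y z"
    and ip_scale: "ip (scl c x) y = c * ip x y"
    and ip_nonneg: "0 \<le> Re (ip x x)"
    and ip_eq_0: "ip x x = 0 \<Longrightarrow> x = 0"
    and ip_complete: "Metric_space.mcomplete UNIV (\<lambda>x y. ip_norm ip (x - y))"

definition linear_isometry_on ::
  "'a set \<Rightarrow> (complex \<Rightarrow> 'a::ab_group_add \<Rightarrow> 'a) \<Rightarrow> ('a \<Rightarrow> real) \<Rightarrow>
   (complex \<Rightarrow> 'h::ab_group_add \<Rightarrow> 'h) \<Rightarrow> ('h \<Rightarrow> real) \<Rightarrow> ('a \<Rightarrow> 'h) \<Rightarrow> bool" where
  "linear_isometry_on S scl\<^sub>1 nrm\<^sub>1 scl\<^sub>2 nrm\<^sub>2 f \<longleftrightarrow>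
     (\<forall>u\<in>S. \<forall>v\<in>S. f (u + v) = f u + f v) \<and>
     (\<forall>c. \<forall>u\<in>S. f (scl\<^sub>1 c u) = scl\<^sub>2 c (f u)) \<and>
     (\<forall>u\<in>S. nrm\<^sub>2 (f u) = nrm\<^sub>1 u)"

text \<open>
  HOL cannot quantify existentially over types inside a formula, so the additive group
  \<open>'h\<close> underlying the Hilbert space is a parameter. In a theorem that assumes
  \<open>pythagoras_orthogonal TYPE('h) \<dots>\<close> and does not mention \<open>'h\<close> in its conclusion, the type
  variable is universally quantified, so such a theorem covers every Hilbert space.
  The lemmas \<open>pythagoras_orthogonal_imp_norm_identity\<close> and
  \<open>norm_identity_imp_pythagoras_orthogonal\<close> below imply that \<open>complex \<times> complex\<close> already
  suffices as a choice of \<open>'h\<close>.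
\<close>

definition pythagoras_orthogonal ::
  "'h::ab_group_add itself \<Rightarrow> (complex \<Rightarrow> 'a::ab_group_add \<Rightarrow> 'a) \<Rightarrow> ('a \<Rightarrow> real) \<Rightarrow>
   'a \<Rightarrow> 'a \<Rightarrow> bool" where
  "pythagoras_orthogonal (H :: 'h itself) scl nrm x y \<longleftrightarrow>
     (\<exists>(hscl :: complex \<Rightarrow> 'h \<Rightarrow> 'h) (ip :: 'h \<Rightarrow> 'h \<Rightarrow> complex) (f :: 'a \<Rightarrow> 'h).
        complex_hilbert_space hscl ip \<and>
        linear_isometry_on (module.span scl {x, y}) scl nrm hscl (ip_norm ip) f \<and>
        ip (f x) (f y) = 0)"

lemma pythagoras_orthogonal_imp_norm_identity:
  fixes x y :: "'a::ab_group_add"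
  assumes "complex_normed_space scl nrm"
    and "pythagoras_orthogonal TYPE('h::ab_group_add) scl nrm x y"
  shows "(nrm (scl \<alpha> x + scl \<beta> y))\<^sup>2 = (cmod \<alpha>)\<^sup>2 * (nrm x)\<^sup>2 + (cmod \<beta>)\<^sup>2 * (nrm y)\<^sup>2"
proof -
  interpret N: complex_normed_space scl nrm by fact
  obtain hs :: "complex \<Rightarrow> 'h \<Rightarrow> 'h" and ip f where H: "complex_hilbert_space hs ip"
    and L: "linear_isometry_on (N.span {x, y}) scl nrm hs (ip_norm ip) f"
    and O: "ip (f x) (f y) = 0"
    using assms(2) unfolding pythagoras_orthogonal_def by blast
  interpret H: complex_hilbert_space hs ip by fact
  have sp: "x \<in> N.span {x, y}" "y \<in> N.span {x, y}"
    "scl \<alpha> x \<in> N.span {x, y}" "scl \<beta> y \<in> N.span {x, y}"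
    "scl \<alpha> x + scl \<beta> y \<in> N.span {x, y}"
    by (auto intro: N.span_base N.span_scale N.span_add)
  have f: "f (scl \<alpha> x + scl \<beta> y) = hs \<alpha> (f x) + hs \<beta> (f y)"
    using L sp unfolding linear_isometry_on_def by simp
  have O': "ip (f y) (f x) = 0" using O H.ip_cnj by (metis complex_cnj_zero)
  have r_add: "ip u (v + w) = ip u v + ip u w" for u v w
    by (metis H.ip_cnj H.ip_add complex_cnj_add)
  have r_sc: "ip u (hs c v) = cnj c * ip u v" for u v c
    by (metis H.ip_cnj H.ip_scale complex_cnj_mult)
  have sq: "(nrm u)\<^sup>2 = Re (ip (f u) (f u))" if "u \<in> N.span {x, y}" for u
    using L that H.ip_nonneg unfolding linear_isometry_on_def ip_norm_def
    by (metis real_sqrt_pow2)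
  have Im0: "Im (ip u u) = 0" for u
    using H.ip_cnj[of u u] by (metis Im_divide_Reals complex_cnj_cancel_iff Reals_cnj_iff complex_is_Real_iff)
  show ?thesis
    unfolding sq[OF sp(5)] sq[OF sp(1)] sq[OF sp(2)] f
    by (simp add: H.ip_add H.ip_scale r_add r_sc O O' cmod_power2 Im0)
       (simp add: algebra_simps power2_eq_square)
qed

lemma complex_hilbert_space_pair:
  "complex_hilbert_space (\<lambda>c (p::complex \<times> complex). (c * fst p, c * snd p))
     (\<lambda>p q. fst p * cnj (fst q) + snd p * cnj (snd q))" (is "complex_hilbert_space ?s ?ip")
proof -
  have nrm: "ip_norm ?ip (p - q) = dist p q" for p q :: "complex \<times> complex"
    by (simp add: ip_norm_def dist_prod_def dist_norm cmod_power2) (simp add: power2_eq_square algebra_simps)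
  have complete: "Metric_space.mcomplete UNIV (\<lambda>p q. ip_norm ?ip (p - q))"
    unfolding nrm by (metis mcomplete_iff_complete complete_UNIV)
  show ?thesis
    by unfold_locales
       (use complete in \<open>auto simp: algebra_simps prod_eq_iff complex_eq_iff
          add_nonneg_eq_0_iff sum_squares_eq_zero_iff\<close>)
qed

lemma norm_identity_imp_pythagoras_orthogonal:
  fixes x y :: "'a::ab_group_add"
  assumes "complex_normed_space scl nrm"
    and id: "\<And>\<alpha> \<beta>. (nrm (scl \<alpha> x + scl \<beta> y))\<^sup>2
                = (cmod \<alpha>)\<^sup>2 * (nrm x)\<^sup>2 + (cmod \<beta>)\<^sup>2 * (nrm y)\<^sup>2"
  shows "pythagoras_orthogonal TYPE(complex \<times> complex) scl nrm x y"
proof -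
  interpret N: complex_normed_space scl nrm by fact
  let ?s = "\<lambda>c (p::complex \<times> complex). (c * fst p, c * snd p)"
  let ?ip = "\<lambda>p q :: complex \<times> complex. fst p * cnj (fst q) + snd p * cnj (snd q)"
  let ?g = "\<lambda>\<alpha> \<beta>. (\<alpha> * of_real (nrm x), \<beta> * of_real (nrm y)) :: complex \<times> complex"
  let ?c = "\<lambda>\<alpha> \<beta>. scl \<alpha> x + scl \<beta> y"
  define f where "f u = (SOME p. \<exists>\<alpha> \<beta>. u = ?c \<alpha> \<beta> \<and> p = ?g \<alpha> \<beta>)" for u
  have wd: "?g \<alpha> \<beta> = ?g \<alpha>' \<beta>'" if "?c \<alpha> \<beta> = ?c \<alpha>' \<beta>'" for \<alpha> \<beta> \<alpha>' \<beta>'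
  proof -
    have "?c (\<alpha> - \<alpha>') (\<beta> - \<beta>') = 0"
      using that by (simp add: N.scale_left_diff_distrib algebra_simps)
    then have "(cmod (\<alpha> - \<alpha>'))\<^sup>2 * (nrm x)\<^sup>2 + (cmod (\<beta> - \<beta>'))\<^sup>2 * (nrm y)\<^sup>2 = 0"
      using id[of "\<alpha> - \<alpha>'" "\<beta> - \<beta>'"] N.nrm_eq_0_iff[of 0] by simp
    then show ?thesis
      by (auto simp: add_nonneg_eq_0_iff)
  qed
  have f: "f (?c \<alpha> \<beta>) = ?g \<alpha> \<beta>" for \<alpha> \<beta>
  proof -
    have "\<exists>\<alpha>' \<beta>'. ?c \<alpha> \<beta> = ?c \<alpha>' \<beta>' \<and> f (?c \<alpha> \<beta>) = ?g \<alpha>' \<beta>'"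
      unfolding f_def by (rule someI_ex) blast
    then show ?thesis using wd by metis
  qed
  have span: "\<exists>\<alpha> \<beta>. u = ?c \<alpha> \<beta>" if "u \<in> N.span {x, y}" for u
    using that by (auto simp: N.span_insert N.span_singleton) (metis diff_add_cancel add.commute)
  have nonneg: "0 \<le> nrm u" for u
    using N.nrm_triangle[of u "scl (-1) u"] N.nrm_scale[of "-1" u] N.nrm_eq_0_iff[of 0] by simp
  have "linear_isometry_on (N.span {x, y}) scl nrm ?s (ip_norm ?ip) f"
    unfolding linear_isometry_on_def
  proof (intro conjI ballI allI)
    fix u v c assume u: "u \<in> N.span {x, y}" and v: "v \<in> N.span {x, y}"
    obtain \<alpha> \<beta> \<alpha>' \<beta>' where uv: "u = ?c \<alpha> \<beta>" "v = ?c \<alpha>' \<beta>'" using span u v by metis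
    have "u + v = ?c (\<alpha> + \<alpha>') (\<beta> + \<beta>')"
      by (simp add: uv N.scale_left_distrib algebra_simps)
    then show "f (u + v) = f u + f v"
      by (simp only: uv f) (simp add: algebra_simps)
  next
    fix u c assume u: "u \<in> N.span {x, y}"
    obtain \<alpha> \<beta> where uv: "u = ?c \<alpha> \<beta>" using span u by metis
    have "scl c u = ?c (c * \<alpha>) (c * \<beta>)"
      by (simp add: uv N.scale_right_distrib)
    then show "f (scl c u) = (c * fst (f u), c * snd (f u))"
      by (simp only: uv f) (simp add: algebra_simps)
  next
    fix u assume u: "u \<in> N.span {x, y}"
    obtain \<alpha> \<beta> where uv: "u = ?c \<alpha> \<beta>" using span u by metis
    have "ip_norm ?ip (f u) = sqrt ((nrm u)\<^sup>2)"
      unfolding uv f id by (simp add: ip_norm_def cmod_power2) (simp add: power2_eq_square algebra_simps)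
    then show "ip_norm ?ip (f u) = nrm u" using nonneg by simp
  qed
  moreover have "?ip (f x) (f y) = 0"
    using f[of 1 0] f[of 0 1] by simp
  ultimately show ?thesis
    unfolding pythagoras_orthogonal_def using complex_hilbert_space_pair by blast
qed

definition matrix_smult :: "complex \<Rightarrow> complex^'n^'n \<Rightarrow> complex^'n^'n" where
  "matrix_smult c A = (\<chi> i j. c * A $ i $ j)"

text \<open>The library norm on \<open>complex^'n\<close> is the Hilbert space norm, so the \<open>onorm\<close> below is
  the operator norm on the Hilbert space; the library norm on matrices is a different one.\<close>

definition matrix_op_norm :: "complex^'n^'n \<Rightarrow> real" where
  "matrix_op_norm A = onorm (\<lambda>v. A *v v)"

lemma complex_normed_space_matrix:
  "complex_normed_space (matrix_smult :: complex \<Rightarrow> complex^'n^'n \<Rightarrow> _) matrix_op_norm"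
proof -
  have bl: "bounded_linear (\<lambda>v. (A :: complex^'n^'n) *v v)" for A
    by (rule matrix_vector_mul_bounded_linear)
  have sc: "matrix_smult c A *v v = c *s (A *v v)" for c v and A :: "complex^'n^'n"
    by (simp add: matrix_smult_def matrix_vector_mult_def vec_eq_iff sum_distrib_left mult.assoc)
  have norm_sc: "norm (c *s v) = cmod c * norm v" for c and v :: "complex^'n"
    by (simp add: norm_vec_def norm_mult L2_set_right_distrib)
  show ?thesis
  proof unfold_locales
    fix c and A :: "complex^'n^'n"
    have "onorm (\<lambda>v. matrix_smult c A *v v) = (SUP v. cmod c * (norm (A *v v) / norm v))"
      by (simp add: onorm_def sc norm_sc)
    also have "\<dots> = cmod c * onorm (\<lambda>v. A *v v)"
      using onorm_scaleR[OF bl, of "cmod c" A]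
      by (simp add: onorm_def abs_mult flip: times_divide_eq_right)
    finally show "matrix_op_norm (matrix_smult c A) = cmod c * matrix_op_norm A"
      by (simp add: matrix_op_norm_def)
  next
    fix A B :: "complex^'n^'n"
    show "matrix_op_norm (A + B) \<le> matrix_op_norm A + matrix_op_norm B"
      unfolding matrix_op_norm_def matrix_vector_mult_add_rdistrib
      by (rule onorm_triangle[OF bl bl])
    show "matrix_op_norm A = 0 \<longleftrightarrow> A = 0"
      unfolding matrix_op_norm_def onorm_eq_0[OF bl]
      by (simp add: matrix_eq)
  qed (simp_all add: matrix_smult_def vec_eq_iff algebra_simps)
qed

end

theory Submission
  imports Defs
begin

text \<open>
  Write \<open>C(s) = A + s B\<close>. As \<open>C(s)\<close> attains its norm,
  \<open>1 + |s|\<^sup>2\<close> is an eigenvalue of \<open>C(s)\<^sup>* C(s)\<close>, so the polynomial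
  \<open>det ((A\<^sup>* + t B\<^sup>*) (A + s B) - (1 + s t))\<close> in two variables vanishes
  whenever \<open>t\<close> is the conjugate of \<open>s\<close>, and hence identically. Putting
  \<open>t = -1/s\<close> gives \<open>det C(s) = 0\<close> or \<open>det C(-1/cnj s) = 0\<close> for every
  \<open>s \<noteq> 0\<close>; since \<open>det C\<close> is a polynomial, it must be zero.
\<close>

text \<open>Polynomiality is a property of functions here, so that closure rules apply directly to
  the determinant of a matrix whose entries depend on a parameter.\<close>

definition polynomial_fun :: "('a::comm_ring_1 \<Rightarrow> 'a) \<Rightarrow> bool" where
  "polynomial_fun f \<longleftrightarrow> (\<exists>p. f = poly p)"

lemma polynomial_fun_const: "polynomial_fun (\<lambda>x. c)"
  unfolding polynomial_fun_def by (rule exI[of _ "[:c:]"]) auto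

lemma polynomial_fun_ident: "polynomial_fun (\<lambda>x. x)"
  unfolding polynomial_fun_def by (rule exI[of _ "[:0, 1:]"]) auto

lemma polynomial_fun_add:
  assumes "polynomial_fun f" "polynomial_fun g"
  shows "polynomial_fun (\<lambda>x. f x + g x)"
  using assms unfolding polynomial_fun_def by (auto simp flip: poly_add)

lemma polynomial_fun_diff:
  assumes "polynomial_fun f" "polynomial_fun g"
  shows "polynomial_fun (\<lambda>x. f x - g x)"
  using assms unfolding polynomial_fun_def by (auto simp flip: poly_diff)

lemma polynomial_fun_mult:
  assumes "polynomial_fun f" "polynomial_fun g"
  shows "polynomial_fun (\<lambda>x. f x * g x)"
  using assms unfolding polynomial_fun_def by (auto simp flip: poly_mult)

lemma polynomial_fun_sum:
  "(\<And>i. i \<in> I \<Longrightarrow> polynomial_fun (f i)) \<Longrightarrow> polynomial_fun (\<lambda>x. \<Sum>i\<in>I. f i x)"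
  by (induction I rule: infinite_finite_induct) (simp_all add: polynomial_fun_const polynomial_fun_add)

lemma polynomial_fun_prod:
  "(\<And>i. i \<in> I \<Longrightarrow> polynomial_fun (f i)) \<Longrightarrow> polynomial_fun (\<lambda>x. \<Prod>i\<in>I. f i x)"
  by (induction I rule: infinite_finite_induct) (simp_all add: polynomial_fun_const polynomial_fun_mult)

lemmas polynomial_fun_intros = polynomial_fun_const polynomial_fun_ident polynomial_fun_add
  polynomial_fun_diff polynomial_fun_mult polynomial_fun_sum polynomial_fun_prod

lemma polynomial_fun_det:
  assumes "\<And>i j. polynomial_fun (\<lambda>x. M x $ i $ j)"
  shows "polynomial_fun (\<lambda>x. det (M x))"
  unfolding det_def
  by (intro polynomial_fun_intros assms)

lemma polynomial_fun_finite_zeros: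
  fixes f :: "'a::idom \<Rightarrow> 'a"
  assumes "polynomial_fun f" "f x \<noteq> 0"
  shows "finite {x. f x = 0}"
proof -
  obtain p where p: "f = poly p"
    using assms(1) unfolding polynomial_fun_def by blast
  then have "p \<noteq> 0"
    using assms(2) by auto
  then show ?thesis
    unfolding p by (rule poly_roots_finite)
qed

lemma polynomial_fun_eq_0_if_real:
  fixes f :: "complex \<Rightarrow> complex"
  assumes "polynomial_fun f" "\<And>r::real. f (of_real r) = 0"
  shows "f x = 0"
proof (rule ccontr)
  assume "f x \<noteq> 0"
  then have "finite {x. f x = 0}"
    by (rule polynomial_fun_finite_zeros[OF assms(1)])
  moreover have "range of_real \<subseteq> {x. f x = 0}"
    using assms(2) by auto
  ultimately have "finite (range (of_real :: real \<Rightarrow> complex))"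
    using finite_subset by blast
  then have "finite (UNIV :: real set)"
    by (rule finite_imageD) (rule inj_of_real)
  then show False
    by (simp add: infinite_UNIV_char_0)
qed

text \<open>In the coordinates s = x + iy, t = x - iy the set t = \<open>cnj s\<close> consists of
  the real pairs (x, y). Vanishing there extends to all complex pairs one coordinate at a time, so
  polynomiality along complex lines is enough.\<close>

lemma polynomial_fun_eq_0_if_conjugate:
  fixes f :: "complex \<Rightarrow> complex \<Rightarrow> complex"
  assumes poly: "\<And>a b c d. polynomial_fun (\<lambda>x. f (a + b * x) (c + d * x))"
    and zero: "\<And>s. f s (cnj s) = 0"
  shows "f s t = 0"
proof -
  \<comment> \<open>First extension: y = b stays real while x becomes complex.\<close>
  have "f (x + \<i> * of_real b) (x - \<i> * of_real b) = 0" for x and b :: real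
  proof (rule polynomial_fun_eq_0_if_real[where f = "\<lambda>x. f (x + \<i> * of_real b) (x - \<i> * of_real b)"])
    show "polynomial_fun (\<lambda>x. f (x + \<i> * of_real b) (x - \<i> * of_real b))"
      using poly[of "\<i> * of_real b" 1 "- \<i> * of_real b" 1] by (simp add: algebra_simps)
    show "f (of_real a + \<i> * of_real b) (of_real a - \<i> * of_real b) = 0" for a
      using zero[of "of_real a + \<i> * of_real b"] by simp
  qed
  \<comment> \<open>Second extension: x is now an arbitrary complex number and y leaves the real
    line.\<close>
  then have "f (x + \<i> * y) (x - \<i> * y) = 0" for x y
    using polynomial_fun_eq_0_if_real[of "\<lambda>y. f (x + \<i> * y) (x - \<i> * y)" y]
      poly[of x \<i> x "- \<i>"] by simp
  \<comment> \<open>These values invert the change of coordinates.\<close>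
  from this[of "(s + t) / 2" "(s - t) / (2 * \<i>)"] show ?thesis
    by (simp add: field_simps)
qed

text \<open>The unit sphere is compact in finite dimension, and homogeneity carries the maximum on
  it to a bound for all vectors.\<close>

lemma onorm_attained:
  fixes f :: "'a::euclidean_space \<Rightarrow> 'b::real_normed_vector"
  assumes "bounded_linear f"
  obtains v where "norm v = 1" "norm (f v) = onorm f"
proof -
  interpret bounded_linear f by fact
  have ne: "sphere (0::'a) 1 \<noteq> {}" by simp
  have "continuous_on (sphere 0 1) (\<lambda>v. norm (f v))"
    by (intro continuous_intros linear_continuous_on assms)
  then obtain v where v: "norm v = 1" and max: "\<And>u. norm u = 1 \<Longrightarrow> norm (f u) \<le> norm (f v)"
    using continuous_attains_sup[OF compact_sphere ne] by fastforce
  have "norm (f x) \<le> norm (f v) * norm x" for x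
  proof (cases "x = 0")
    case False
    then show ?thesis
      using max[of "x /\<^sub>R norm x"] by (simp add: scaleR field_simps)
  qed (simp add: zero)
  then have "onorm f \<le> norm (f v)"
    by (simp add: onorm_bound)
  moreover have "norm (f v) \<le> onorm f"
    using onorm[OF assms, of v] v by simp
  ultimately show thesis
    using that v by simp
qed

text \<open>Let r be the operator norm, attained at a unit vector v. Expanding the square of the
  norm of g (f v) - r^2 v gives at most r^4 - 2 r^4 + r^4 = 0, so v is an eigenvector without any
  appeal to the spectral theorem.\<close>

lemma onorm_square_eigenvector:
  fixes f :: "'a::euclidean_space \<Rightarrow> 'b::real_inner"
  assumes f: "bounded_linear f" and adj: "\<And>x y. inner (f x) y = inner x (g y)"
  obtains v where "v \<noteq> 0" "g (f v) = (onorm f)\<^sup>2 *\<^sub>R v"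
proof -
  define r where "r = onorm f"
  obtain v where v: "norm v = 1" "norm (f v) = r"
    using onorm_attained[OF f] unfolding r_def by metis
  \<comment> \<open>The adjoint obeys the same bound r: the square of the norm of g y is the inner
    product of f (g y) with y.\<close>
  have "norm (g y) \<le> r * norm y" for y
  proof (cases "g y = 0")
    case False
    have "norm (g y) * norm (g y) = inner (f (g y)) y"
      by (simp add: adj flip: power2_norm_eq_inner power2_eq_square)
    also have "\<dots> \<le> norm (f (g y)) * norm y"
      by (rule norm_cauchy_schwarz)
    also have "\<dots> \<le> (r * norm (g y)) * norm y"
      unfolding r_def by (intro mult_right_mono onorm[OF f]) auto
    finally show ?thesis
      using False by (simp add: mult_ac)
  qed (use v in \<open>auto intro: mult_nonneg_nonneg\<close>)
  from this[of "f v"] have g: "norm (g (f v)) \<le> r\<^sup>2"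
    by (simp add: v power2_eq_square)
  have "(norm (g (f v) - r\<^sup>2 *\<^sub>R v))\<^sup>2
      = (norm (g (f v)))\<^sup>2 - 2 * r\<^sup>2 * inner v (g (f v)) + (r\<^sup>2)\<^sup>2 * (norm v)\<^sup>2"
    unfolding power2_norm_eq_inner
    by (simp add: inner_diff_left inner_diff_right inner_commute power2_eq_square algebra_simps)
  also have "inner v (g (f v)) = r\<^sup>2"
    using v by (simp flip: adj power2_norm_eq_inner)
  also have "(norm (g (f v)))\<^sup>2 \<le> (r\<^sup>2)\<^sup>2"
    using g by (rule power_mono) simp
  finally have "(norm (g (f v) - r\<^sup>2 *\<^sub>R v))\<^sup>2 \<le> 0"
    using v by (simp add: power2_eq_square)
  then have "g (f v) = r\<^sup>2 *\<^sub>R v"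
    by simp
  then show thesis
    using that[of v] v unfolding r_def by fastforce
qed

definition conj_transpose :: "complex^'n^'m \<Rightarrow> complex^'m^'n" where
  "conj_transpose A = (\<chi> i j. cnj (A $ j $ i))"

text \<open>The library's \<open>inner\<close> is the real part of the Hermitian product, so the
  Hermitian adjoint is also the adjoint for \<open>inner\<close>.\<close>

lemma inner_conj_transpose:
  fixes A :: "complex^'n^'m"
  shows "inner (A *v x) y = inner x (conj_transpose A *v y)"
proof -
  have inner: "inner u v = Re (\<Sum>i\<in>UNIV. u $ i * cnj (v $ i))" for u v :: "complex^'k"
    by (simp add: inner_vec_def inner_complex_def)
  have "(\<Sum>i\<in>UNIV. (A *v x) $ i * cnj (y $ i))
      = (\<Sum>i\<in>UNIV. \<Sum>j\<in>UNIV. A $ i $ j * x $ j * cnj (y $ i))"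
    by (simp add: matrix_vector_mult_def sum_distrib_right)
  also have "\<dots> = (\<Sum>j\<in>UNIV. \<Sum>i\<in>UNIV. A $ i $ j * x $ j * cnj (y $ i))"
    by (rule sum.swap)
  also have "\<dots> = (\<Sum>j\<in>UNIV. x $ j * cnj ((conj_transpose A *v y) $ j))"
    by (simp add: conj_transpose_def matrix_vector_mult_def sum_distrib_left mult_ac)
  finally show ?thesis
    by (simp only: inner)
qed

lemma det_conj_transpose: "det (conj_transpose A) = cnj (det A)"
proof -
  have "det (conj_transpose A) = det (transpose (\<chi> i j. cnj (A $ i $ j)))"
    by (simp add: conj_transpose_def transpose_def)
  also have "\<dots> = cnj (det A)"
    unfolding det_transpose by (simp add: det_def)
  finally show ?thesis .
qed

lemma det_eq_0_if_kernel:
  fixes A :: "'a::field^'n^'n"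
  assumes "A *v v = 0" "v \<noteq> 0"
  shows "det A = 0"
  using assms invertible_det_nz[of A] invertible_left_inverse[of A] matrix_left_invertible_ker[of A]
  by blast

lemma det_op_norm_square_eq_0:
  fixes A :: "complex^'n^'n"
  shows "det (conj_transpose A ** A - mat (of_real ((matrix_op_norm A)\<^sup>2))) = 0"
proof -
  obtain v where v: "v \<noteq> 0" "conj_transpose A *v (A *v v) = (matrix_op_norm A)\<^sup>2 *\<^sub>R v"
    using onorm_square_eigenvector[OF matrix_vector_mul_bounded_linear inner_conj_transpose]
    unfolding matrix_op_norm_def by metis
  have mat: "mat c *v v = c *s v" for c :: complex
    by (simp add: vec_eq_iff matrix_vector_mult_def mat_def if_distrib[of "\<lambda>x. x * _"] cong: if_cong)
  have "(conj_transpose A ** A - mat (of_real ((matrix_op_norm A)\<^sup>2))) *v v = 0"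
    unfolding matrix_vector_mult_diff_rdistrib mat matrix_vector_mul_assoc[symmetric] v
    by (simp add: vec_eq_iff scaleR_conv_of_real[where 'a = complex])
  then show ?thesis
    using v(1) by (rule det_eq_0_if_kernel)
qed

theorem proposition2p2:
  fixes A B :: "complex^'n^'n"
  assumes "matrix_op_norm A = 1" and "matrix_op_norm B = 1"
    and "pythagoras_orthogonal TYPE('h::ab_group_add) matrix_smult matrix_op_norm A B"
  shows "\<forall>c :: complex. \<not> invertible (A + matrix_smult c B)"
proof (intro allI notI)
  fix c
  assume inv: "invertible (A + matrix_smult c B)"
  let ?C = "\<lambda>s. A + matrix_smult s B"
  \<comment> \<open>The adjoint of \<open>?C s\<close> involves \<open>cnj s\<close> and is not
    polynomial in s. \<open>?D\<close> replaces \<open>cnj s\<close> by an independent variable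
    t.\<close>
  let ?D = "\<lambda>t. conj_transpose A + matrix_smult t (conj_transpose B)"
  have D: "?D t = conj_transpose (?C (cnj t))" for t
    by (simp add: conj_transpose_def matrix_smult_def vec_eq_iff)
  have norm: "(matrix_op_norm (?C s))\<^sup>2 = 1 + (cmod s)\<^sup>2" for s
    using pythagoras_orthogonal_imp_norm_identity[OF complex_normed_space_matrix assms(3), of 1 s]
    by (simp add: assms) (simp add: matrix_smult_def)
  have vanish: "det (?D t ** ?C s - mat (1 + s * t)) = 0" for s t
  proof (rule polynomial_fun_eq_0_if_conjugate[where f = "\<lambda>s t. det (?D t ** ?C s - mat (1 + s * t))"])
    show "polynomial_fun (\<lambda>x. det (?D (k + l * x) ** ?C (a + b * x) - mat (1 + (a + b * x) * (k + l * x))))"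
      for a b k l
    proof (rule polynomial_fun_det)
      show "polynomial_fun (\<lambda>x. (?D (k + l * x) ** ?C (a + b * x) - mat (1 + (a + b * x) * (k + l * x))) $ i $ j)"
        for i j
        \<comment> \<open>The case split removes the conditional in the entries of
          \<open>mat\<close>.\<close>
        by (cases "i = j"; simp add: matrix_matrix_mult_def matrix_smult_def mat_def)
          (intro polynomial_fun_intros)+
    qed
    show "det (?D (cnj s) ** ?C s - mat (1 + s * cnj s)) = 0" for s
      using det_op_norm_square_eq_0[of "?C s"]
      by (simp only: norm D complex_cnj_cnj complex_norm_square of_real_add of_real_1)
  qed
  \<comment> \<open>For t = -1/s the scalar 1 + s t is zero, so only the product remains and its
    determinant factors.\<close>
  have "det (?D (- 1 / s) ** ?C s) = 0" if "s \<noteq> 0" for s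
    using vanish[of "- 1 / s" s] that by simp
  then have zero: "det (?C (- 1 / cnj s)) = 0 \<or> det (?C s) = 0" if "s \<noteq> 0" for s
    using that by (simp add: det_mul D det_conj_transpose)
  define Z where "Z = {s. det (?C s) = 0}"
  have "polynomial_fun (\<lambda>s. det (?C s))"
    by (rule polynomial_fun_det) (simp add: matrix_smult_def, intro polynomial_fun_intros)
  moreover have "det (?C c) \<noteq> 0"
    using inv by (simp add: invertible_det_nz)
  ultimately have "finite Z"
    unfolding Z_def by (rule polynomial_fun_finite_zeros)
  \<comment> \<open>The map s \<mapsto> -1/\<open>cnj s\<close> is an involution, so each nonzero s
    lies in \<open>Z\<close> or is the image of a point of \<open>Z\<close>. A finite
    \<open>Z\<close> would make the plane finite.\<close>
  moreover have "UNIV \<subseteq> {0} \<union> Z \<union> (\<lambda>s. - 1 / cnj s) ` Z"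
  proof
    fix s :: complex
    \<comment> \<open>This includes s = 0, since division by zero yields 0.\<close>
    have "s = - 1 / cnj (- 1 / cnj s)" by simp
    then show "s \<in> {0} \<union> Z \<union> (\<lambda>s. - 1 / cnj s) ` Z"
      using zero[of s] unfolding Z_def by blast
  qed
  ultimately have "finite (UNIV :: complex set)"
    by (meson finite.emptyI finite.insertI finite_UnI finite_imageI finite_subset)
  then show False
    using infinite_UNIV_char_0 by blast
qed

end
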